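(* Let $f\in\mathrm{Lip}(I\times J)$ be the germ function. (1) Assume that the partition $\Delta$ and the scale function $\alpha$ are fixed. Let $(L_n)_{n\in\mathbb{N}}$ be a sequence of operators on $\mathrm{Lip}(I\times J)$ such that $(L_n(f))(x_k,y_l)=f(x_k,y_l)$ for all $k,l\in\{0,\infty\}$ and each $n\in\mathbb{N}$, and such that $L_n(f)\to f$ uniformly. Then the sequence $\big(f^{\alpha}_{\Delta,L_n}\big)_{n\in\mathbb{N}}$ of $\alpha$-fractal functions associated with $f$ converges uniformly to $f$. (2) Assume that the partition $\Delta$ and the operator $L:\mathrm{Lip}(I\times J)\to\mathrm{Lip}(I\times J)$ are fixed. Let $(\alpha^n)_{n\in\mathbb{N}}$, $\alpha^n=(\alpha^n_{ij})_{i,j\in\mathbb{N}}$, be a sequence of scale functions such that $\|\alpha^n\|_\infty\to0$ as $n\to\infty$. Then the sequence $\big(f^{\alpha^n}_{\Delta,L}\big)_{n\in\mathbb{N}}$ converges uniformly to $f$.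
   Context: Let $a<b$, $c<d$, $I=[a,b]$, $J=[c,d]$, $\mathbb{N}=\{1,2,\dots\}$, $\mathbb{N}_0=\mathbb{N}\cup\{0\}$. $\mathcal{C}(I\times J)$ is the space of continuous real-valued functions on $I\times J$ with sup-norm $\|\cdot\|_\infty$; $\mathrm{Lip}(I\times J)\subset\mathcal{C}(I\times J)$ is the set of Lipschitz functions (Euclidean norm on $\mathbb{R}^2$). Partition: $\Delta=\{x_i:i\in\mathbb{N}_0\}\times\{y_j:j\in\mathbb{N}_0\}$ with $(x_i)$, $(y_j)$ strictly increasing, $x_0=a$, $y_0=c$, $x_i\to b=:x_\infty$, $y_j\to d=:y_\infty$. Put $I_i=[x_{i-1},x_i]$, $J_j=[y_{j-1},y_j]$ for $i,j\in\mathbb{N}$. Affine maps: $u_i:I\to I_i$ is the affine bijection with $u_i(a)=x_{i-1}$, $u_i(b)=x_i$ if $i$ is odd, and $u_i(a)=x_i$, $u_i(b)=x_{i-1}$ if $i$ is even; $v_j:J\to J_j$ is defined likewise with the $y_j$. Scale function: a double sequence $\alpha=(\alpha_{ij})_{i,j\in\mathbb{N}}$ of Lipschitz functions on $I\times J$ with uniformly bounded Lipschitz constants and $\|\alpha\|_\infty:=\sup_{i,j}\|\alpha_{ij}\|_\infty<1$. In (2), $L$ is a (not necessarily linear or bounded) operator with $L(f)(x_k,y_l)=f(x_k,y_l)$ for all $f$ and all $k,l\in\{0,\infty\}$. $\alpha$-fractal function: for $f\in\mathrm{Lip}(I\times J)$, any partition $\Delta$, any scale function $\alpha$ and any operator $L$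 on $\mathrm{Lip}(I\times J)$ with $L(f)(x_k,y_l)=f(x_k,y_l)$ for $k,l\in\{0,\infty\}$, $f^{\alpha}_{\Delta,L}$ denotes the unique function in $\mathcal{C}(I\times J)$ that agrees with $f$ at all points $(x_i,y_j)$, $i,j\in\mathbb{N}_0$, and at the points $(x_k,y_l)$, $k,l\in\{0,\infty\}$, and satisfies, writing $R_{ij}(x,y)=f^{\alpha}_{\Delta,L}(u_i^{-1}(x),v_j^{-1}(y))-L(f)(u_i^{-1}(x),v_j^{-1}(y))$: (i) $f^{\alpha}_{\Delta,L}(x,y)=f(x,y)+\alpha_{ij}(x,y)R_{ij}(x,y)$ if $(x,y)\in I_i\times J_j$, $i,j\in\mathbb{N}$; (ii) $f^{\alpha}_{\Delta,L}(x,d)=f(x,d)+\lim_{j\to\infty}\alpha_{ij}(x,d)R_{ij}(x,y_j)$ if $x\in I_i$; (iii) $f^{\alpha}_{\Delta,L}(b,y)=f(b,y)+\lim_{i\to\infty}\alpha_{ij}(b,y)R_{ij}(x_i,y)$ if $y\in J_j$; (iv) $f^{\alpha}_{\Delta,L}(b,d)=f(b,d)$. *)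

theory Defs
  imports "HOL-Analysis.Analysis"
begin

text \<open>
  A real function on the rectangle \<open>S = {a..b} \<times> {c..d}\<close> is represented by a total function that
  is \<open>extensional\<close> on \<open>S\<close>. Thus two functions in one of the following two sets are equal iff they
  agree on \<open>S\<close>, and an operator on \<open>Lip S\<close> cannot depend on values outside \<open>S\<close>.
  The metric of \<open>real \<times> real\<close> is the Euclidean one.
\<close>

definition Cont :: "(real \<times> real) set \<Rightarrow> (real \<times> real \<Rightarrow> real) set" where
  "Cont S = {f \<in> extensional S. continuous_on S f}"

definition Lip :: "(real \<times> real) set \<Rightarrow> (real \<times> real \<Rightarrow> real) set" where
  "Lip S = {f \<in> extensional S. \<exists>K. K-lipschitz_on S f}"

text \<open>One coordinate of a partition; the point with index \<open>\<infinity>\<close> is the limit \<open>b\<close>.\<close>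

definition partition_seq :: "real \<Rightarrow> real \<Rightarrow> (nat \<Rightarrow> real) \<Rightarrow> bool" where
  "partition_seq a b x \<longleftrightarrow> strict_mono x \<and> x 0 = a \<and> x \<longlonglongrightarrow> b"

text \<open>The cells and the affine maps are indexed by \<open>i \<ge> 1\<close>; their value for \<open>i = 0\<close> is never used.\<close>

definition cell :: "(nat \<Rightarrow> real) \<Rightarrow> nat \<Rightarrow> real set" where
  "cell x i = {x (i - 1)..x i}"

definition cell_map :: "real \<Rightarrow> real \<Rightarrow> (nat \<Rightarrow> real) \<Rightarrow> nat \<Rightarrow> real \<Rightarrow> real" where
  "cell_map a b x i t =
     (if odd i then x (i - 1) + (t - a) / (b - a) * (x i - x (i - 1))
      else x i + (t - a) / (b - a) * (x (i - 1) - x i))"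

abbreviation cell_inv :: "real \<Rightarrow> real \<Rightarrow> (nat \<Rightarrow> real) \<Rightarrow> nat \<Rightarrow> real \<Rightarrow> real" where
  "cell_inv a b x i \<equiv> inv_into {a..b} (cell_map a b x i)"

text \<open>The norms are taken in \<open>ereal\<close>, so that an unbounded family has norm \<open>\<infinity>\<close>.\<close>

definition sup_norm :: "(real \<times> real) set \<Rightarrow> (real \<times> real \<Rightarrow> real) \<Rightarrow> ereal" where
  "sup_norm S f = (SUP p\<in>S. ereal \<bar>f p\<bar>)"

definition scale_norm :: "(real \<times> real) set \<Rightarrow> (nat \<Rightarrow> nat \<Rightarrow> real \<times> real \<Rightarrow> real) \<Rightarrow> ereal" where
  "scale_norm S \<alpha> = (SUP (i, j)\<in>{1..} \<times> {1..}. sup_norm S (\<alpha> i j))"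

definition scale_function :: "(real \<times> real) set \<Rightarrow> (nat \<Rightarrow> nat \<Rightarrow> real \<times> real \<Rightarrow> real) \<Rightarrow> bool" where
  "scale_function S \<alpha> \<longleftrightarrow>
     (\<exists>K. \<forall>i\<ge>1. \<forall>j\<ge>1. K-lipschitz_on S (\<alpha> i j)) \<and> scale_norm S \<alpha> < 1"

text \<open>
  The predicate states that \<open>g\<close> is the \<open>\<alpha>\<close>-fractal function of \<open>f\<close> for the partition
  given by \<open>x\<close> and \<open>y\<close>, the scale function \<open>\<alpha>\<close> and the operator \<open>L\<close>. There is at most one
  such \<open>g\<close>, see \<open>alpha_fractal_function_unique\<close> below. The two boundary conditions include the
  existence of the limits.
\<close>

definition is_alpha_fractal_function ::
  "real \<Rightarrow> real \<Rightarrow> real \<Rightarrow> real \<Rightarrow> (nat \<Rightarrow> real) \<Rightarrow> (nat \<Rightarrow> real) \<Rightarrow>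
   (nat \<Rightarrow> nat \<Rightarrow> real \<times> real \<Rightarrow> real) \<Rightarrow> ((real \<times> real \<Rightarrow> real) \<Rightarrow> (real \<times> real \<Rightarrow> real)) \<Rightarrow>
   (real \<times> real \<Rightarrow> real) \<Rightarrow> (real \<times> real \<Rightarrow> real) \<Rightarrow> bool" where
  "is_alpha_fractal_function a b c d x y \<alpha> L f g \<longleftrightarrow>
     (let R = (\<lambda>i j (s, t). g (cell_inv a b x i s, cell_inv c d y j t)
                          - L f (cell_inv a b x i s, cell_inv c d y j t))
      in g \<in> Cont ({a..b} \<times> {c..d}) \<and>
         (\<forall>i j. g (x i, y j) = f (x i, y j)) \<and>
         (\<forall>p \<in> {a, b} \<times> {c, d}. g p = f p) \<and>
         (\<forall>i\<ge>1. \<forall>j\<ge>1. \<forall>s \<in> cell x i. \<forall>t \<in> cell y j.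
            g (s, t) = f (s, t) + \<alpha> i j (s, t) * R i j (s, t)) \<and>
         (\<forall>i\<ge>1. \<forall>s \<in> cell x i.
            \<exists>l. (\<lambda>j. \<alpha> i j (s, d) * R i j (s, y j)) \<longlonglongrightarrow> l \<and> g (s, d) = f (s, d) + l) \<and>
         (\<forall>j\<ge>1. \<forall>t \<in> cell y j.
            \<exists>l. (\<lambda>i. \<alpha> i j (b, t) * R i j (x i, t)) \<longlonglongrightarrow> l \<and> g (b, t) = f (b, t) + l) \<and>
         g (b, d) = f (b, d))"

lemma cell_inv_mem:
  assumes "a < b" "partition_seq a b x" "i \<ge> 1" "s \<in> cell x i"
  shows "cell_inv a b x i s \<in> {a..b}"
proof -
  let ?u = "x (i - 1)" and ?v = "x i"
  have lt: "?u < ?v"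
    using assms by (auto simp: partition_seq_def strict_mono_def)
  have s: "?u \<le> s" "s \<le> ?v"
    using assms by (auto simp: cell_def)
  have "s \<in> cell_map a b x i ` {a..b}"
  proof (cases "odd i")
    case True
    let ?r = "(s - ?u) / (?v - ?u)"
    have r: "0 \<le> ?r" "?r \<le> 1"
      using lt s by (auto simp: field_simps)
    have "(b - a) * ?r \<le> (b - a) * 1" "0 \<le> (b - a) * ?r"
      using r assms(1) by (intro mult_left_mono mult_nonneg_nonneg; simp)+
    then have "a + (b - a) * ?r \<in> {a..b}" by simp
    moreover have "cell_map a b x i (a + (b - a) * ?r) = s"
      using True lt assms(1) by (simp add: cell_map_def)
    ultimately show ?thesis by (metis imageI)
  next
    case False
    let ?r = "(?v - s) / (?v - ?u)"
    have r: "0 \<le> ?r" "?r \<le> 1"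
      using lt s by (auto simp: field_simps)
    have "(b - a) * ?r \<le> (b - a) * 1" "0 \<le> (b - a) * ?r"
      using r assms(1) by (intro mult_left_mono mult_nonneg_nonneg; simp)+
    then have "a + (b - a) * ?r \<in> {a..b}" by simp
    moreover have "?r * (?u - ?v) = s - ?v"
      using lt by (simp add: field_simps)
    then have "cell_map a b x i (a + (b - a) * ?r) = s"
      using False assms(1) by (simp add: cell_map_def)
    ultimately show ?thesis by (metis imageI)
  qed
  then show ?thesis by (rule inv_into_into)
qed

lemma cell_cover:
  assumes "partition_seq a b x" "s \<in> {a..<b}"
  obtains i where "i \<ge> 1" "s \<in> cell x i"
proof -
  have "\<forall>\<^sub>F n in sequentially. s < x n"
    using assms by (intro order_tendstoD) (auto simp: partition_seq_def)
  then obtain n where n: "s < x n"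
    by (auto simp: eventually_sequentially)
  define i where "i = (LEAST i. s < x i)"
  have i: "s < x i"
    unfolding i_def using n by (rule LeastI)
  have "i \<noteq> 0"
    using i assms by (auto simp: partition_seq_def intro: ccontr)
  then have "\<not> s < x (i - 1)"
    unfolding i_def by (intro not_less_Least) auto
  with i \<open>i \<noteq> 0\<close> show thesis
    by (intro that[of i]) (auto simp: cell_def)
qed

lemma scale_norm_upper:
  assumes "i \<ge> 1" "j \<ge> 1" "p \<in> S"
  shows "ereal \<bar>\<alpha> i j p\<bar> \<le> scale_norm S \<alpha>"
proof -
  have "ereal \<bar>\<alpha> i j p\<bar> \<le> sup_norm S (\<alpha> i j)"
    unfolding sup_norm_def using assms(3) by (rule SUP_upper)
  also have "\<dots> \<le> scale_norm S \<alpha>"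
    unfolding scale_norm_def using assms(1,2) by (intro SUP_upper2[of "(i, j)"]) auto
  finally show ?thesis .
qed

lemma alpha_fractal_function_unique:
  assumes "a < b" "c < d" and x: "partition_seq a b x" and y: "partition_seq c d y"
    and \<alpha>: "scale_function ({a..b} \<times> {c..d}) \<alpha>"
    and g: "is_alpha_fractal_function a b c d x y \<alpha> L f g"
    and h: "is_alpha_fractal_function a b c d x y \<alpha> L f h"
  shows "g = h"
proof -
  let ?S = "{a..b} \<times> {c..d}" and ?k = "\<lambda>p. \<bar>g p - h p\<bar>"
  have cont: "continuous_on ?S ?k"
    using g h unfolding is_alpha_fractal_function_def Let_def Cont_def
    by (auto intro!: continuous_intros)
  obtain m where m: "m \<in> ?S" and max: "\<And>p. p \<in> ?S \<Longrightarrow> ?k p \<le> ?k m"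
    using continuous_attains_sup[OF _ _ cont] assms(1,2) by (auto simp: compact_Times)
  obtain r where r: "scale_norm ?S \<alpha> = ereal r"
  proof -
    have "0 \<le> ereal \<bar>\<alpha> 1 1 m\<bar>" by simp
    also have "\<dots> \<le> scale_norm ?S \<alpha>" using m by (intro scale_norm_upper) auto
    finally show thesis
      using \<alpha> that by (cases "scale_norm ?S \<alpha>") (auto simp: scale_function_def)
  qed
  have r1: "r < 1"
    using \<alpha> r by (simp add: scale_function_def)
  have r_upper: "\<bar>\<alpha> i j p\<bar> \<le> r" if "i \<ge> 1" "j \<ge> 1" "p \<in> ?S" for i j p
    using scale_norm_upper[OF that, of \<alpha>] r by simp
  have inner: "?k p \<le> r * ?k m" if p: "p \<in> {a..<b} \<times> {c..<d}" for p
  proof -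
    obtain s t where st: "p = (s, t)" "s \<in> {a..<b}" "t \<in> {c..<d}"
      using p by auto
    obtain i where i: "i \<ge> 1" "s \<in> cell x i" using cell_cover[OF x st(2)] .
    obtain j where j: "j \<ge> 1" "t \<in> cell y j" using cell_cover[OF y st(3)] .
    define q where "q = (cell_inv a b x i s, cell_inv c d y j t)"
    have q: "q \<in> ?S"
      using cell_inv_mem[OF assms(1) x i] cell_inv_mem[OF assms(2) y j] by (simp add: q_def)
    have "g p = f p + \<alpha> i j p * (g q - L f q)"
      using g i j by (auto simp: is_alpha_fractal_function_def Let_def q_def st)
    moreover have "h p = f p + \<alpha> i j p * (h q - L f q)"
      using h i j by (auto simp: is_alpha_fractal_function_def Let_def q_def st)
    ultimately have "g p - h p = \<alpha> i j p * (g q - h q)"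
      by (simp add: algebra_simps)
    then have "?k p = \<bar>\<alpha> i j p\<bar> * ?k q"
      by (simp add: abs_mult)
    also have "\<dots> \<le> r * ?k m"
      using r_upper[OF i(1) j(1), of p] max[OF q] st
      by (intro mult_mono order.trans[OF abs_ge_zero r_upper[OF i(1) j(1) q]]) auto
    finally show ?thesis .
  qed
  have closure: "closure ({a..<b} \<times> {c..<d}) = ?S"
    using assms(1,2) by (simp add: closure_Times)
  have "?k m \<le> r * ?k m"
    by (rule continuous_le_on_closure[of "{a..<b} \<times> {c..<d}" ?k])
       (use cont closure m inner in auto)
  then have "(1 - r) * ?k m \<le> 0"
    by (simp add: algebra_simps)
  then have "?k m \<le> 0"
    using r1 by (simp add: mult_le_0_iff)
  then have "g p = h p" if "p \<in> ?S" for p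
    using max[OF that] by simp
  then show ?thesis
    using g h by (intro extensionalityI[of g ?S h])
      (auto simp: is_alpha_fractal_function_def Let_def Cont_def)
qed

end

theory Submission
  imports Defs
begin

text \<open>
  On a cell, the fractal function \<open>g\<close> satisfies \<open>g - f = \<alpha>\<^sub>i\<^sub>j ((g - f) + (f - L f))\<close>, the bracket being
  taken at a preimage point. The cells cover the rectangle up to its sides \<open>x = b\<close> and \<open>y = d\<close>, which
  continuity takes care of. Hence
  \<open>\<parallel>g - f\<parallel> \<le> \<parallel>\<alpha>\<parallel> / (1 - \<parallel>\<alpha>\<parallel>) \<cdot> \<parallel>f - L f\<parallel>\<close>, whose right-hand side tends to \<open>0\<close> if \<open>L f\<close> tends to \<open>f\<close>
  and also if \<open>\<parallel>\<alpha>\<parallel>\<close> tends to \<open>0\<close>.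
\<close>

lemma Lip_continuous_on: "f \<in> Lip S \<Longrightarrow> continuous_on S f"
  by (auto simp: Lip_def intro: lipschitz_on_continuous_on)

text \<open>Passes from the \<open>ereal\<close> norm to a real bound. A point of \<open>S\<close>
  is what forces the norm to be nonnegative: over the empty set the supremum in \<open>ereal\<close>
  is minus infinity.\<close>

lemma scale_function_bound:
  assumes "scale_function S \<alpha>" and "S \<noteq> {}"
  obtains r where "scale_norm S \<alpha> = ereal r" "0 \<le> r" "r < 1"
    "\<And>i j p. i \<ge> 1 \<Longrightarrow> j \<ge> 1 \<Longrightarrow> p \<in> S \<Longrightarrow> \<bar>\<alpha> i j p\<bar> \<le> r"
proof -
  obtain m where m: "m \<in> S" using assms(2) by blast
  have "0 \<le> ereal \<bar>\<alpha> 1 1 m\<bar>" by simp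
  also have "\<dots> \<le> scale_norm S \<alpha>" using m by (intro scale_norm_upper) auto
  finally have nonneg: "0 \<le> scale_norm S \<alpha>" .
  have less: "scale_norm S \<alpha> < 1"
    using assms(1) by (simp add: scale_function_def)
  obtain r where r: "scale_norm S \<alpha> = ereal r"
    using nonneg less by (cases "scale_norm S \<alpha>") auto
  show thesis
  proof (rule that[OF r])
    show "\<bar>\<alpha> i j p\<bar> \<le> r" if "i \<ge> 1" "j \<ge> 1" "p \<in> S" for i j p
      using scale_norm_upper[OF that, of \<alpha>] r by simp
  qed (use nonneg less r in auto)
qed

text \<open>The maximum argument of \<open>alpha_fractal_function_unique\<close> with
  \<open>f\<close> in place of \<open>h\<close>: as \<open>f\<close> solves the functional equation
  only up to the defect \<open>L f - f\<close>, a term in \<open>e\<close> remains. Both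
  \<open>r\<close> and \<open>e\<close> are arbitrary upper bounds, so that either one can be held
  fixed while the other varies with \<open>n\<close>.\<close>

lemma alpha_fractal_function_error:
  assumes "a < b" "c < d" and x: "partition_seq a b x" and y: "partition_seq c d y"
    and f: "continuous_on ({a..b} \<times> {c..d}) f"
    and g: "is_alpha_fractal_function a b c d x y \<alpha> L f g"
    and r: "0 \<le> r" "r < 1"
      "\<And>i j p. i \<ge> 1 \<Longrightarrow> j \<ge> 1 \<Longrightarrow> p \<in> {a..b} \<times> {c..d} \<Longrightarrow> \<bar>\<alpha> i j p\<bar> \<le> r"
    and e: "\<And>p. p \<in> {a..b} \<times> {c..d} \<Longrightarrow> \<bar>L f p - f p\<bar> \<le> e"
    and p: "p \<in> {a..b} \<times> {c..d}"
  shows "\<bar>g p - f p\<bar> \<le> r / (1 - r) * e"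
proof -
  let ?S = "{a..b} \<times> {c..d}" and ?k = "\<lambda>p. \<bar>g p - f p\<bar>"
  have cont: "continuous_on ?S ?k"
    using f g unfolding is_alpha_fractal_function_def Let_def Cont_def
    by (auto intro!: continuous_intros)
  \<comment> \<open>A maximal error at \<open>m\<close> bounds the error at every preimage point
    \<open>q\<close>, which turns the functional equation into an inequality for \<open>?k m\<close>
    alone.\<close>
  obtain m where m: "m \<in> ?S" and max: "\<And>p. p \<in> ?S \<Longrightarrow> ?k p \<le> ?k m"
    using continuous_attains_sup[OF _ _ cont] assms(1,2) by (auto simp: compact_Times)
  have inner: "?k p \<le> r * (?k m + e)" if p: "p \<in> {a..<b} \<times> {c..<d}" for p
  proof -
    obtain s t where st: "p = (s, t)" "s \<in> {a..<b}" "t \<in> {c..<d}"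
      using p by auto
    obtain i where i: "i \<ge> 1" "s \<in> cell x i" using cell_cover[OF x st(2)] .
    obtain j where j: "j \<ge> 1" "t \<in> cell y j" using cell_cover[OF y st(3)] .
    define q where "q = (cell_inv a b x i s, cell_inv c d y j t)"
    have q: "q \<in> ?S"
      using cell_inv_mem[OF assms(1) x i] cell_inv_mem[OF assms(2) y j] by (simp add: q_def)
    have "g p = f p + \<alpha> i j p * (g q - L f q)"
      using g i j by (auto simp: is_alpha_fractal_function_def Let_def q_def st)
    then have "?k p = \<bar>\<alpha> i j p\<bar> * \<bar>g q - L f q\<bar>"
      by (simp add: abs_mult)
    also have "\<dots> \<le> r * (?k m + e)"
    proof (rule mult_mono)
      show "\<bar>\<alpha> i j p\<bar> \<le> r" using r(3)[OF i(1) j(1)] st by auto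
      \<comment> \<open>Triangle inequality through \<open>f q\<close>.\<close>
      show "\<bar>g q - L f q\<bar> \<le> ?k m + e" using max[OF q] e[OF q] by linarith
    qed (use r in auto)
    finally show ?thesis .
  qed
  have closure: "closure ({a..<b} \<times> {c..<d}) = ?S"
    using assms(1,2) by (simp add: closure_Times)
  \<comment> \<open>The maximum may lie on a side \<open>x = b\<close> or \<open>y = d\<close>,
    outside all cells; the right-hand side is constant, so the bound extends to the closure.\<close>
  have "?k m \<le> r * (?k m + e)"
    by (rule continuous_le_on_closure[of "{a..<b} \<times> {c..<d}" ?k])
       (use cont closure m inner in auto)
  \<comment> \<open>The term \<open>r * ?k m\<close> is absorbed on the left, and
    \<open>1 - r\<close> is positive.\<close>
  then have "?k m \<le> r / (1 - r) * e"
    using r(2) by (simp add: field_simps)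
  then show ?thesis
    using max[OF p] by linarith
qed

theorem corollary4p10:
  fixes a b c d :: real and x y :: "nat \<Rightarrow> real" and f :: "real \<times> real \<Rightarrow> real"
  assumes "a < b" and "c < d"
    and "partition_seq a b x" and "partition_seq c d y"
    and "f \<in> Lip ({a..b} \<times> {c..d})"
  shows
    "(\<forall>(\<alpha> :: nat \<Rightarrow> nat \<Rightarrow> real \<times> real \<Rightarrow> real)
       (L :: nat \<Rightarrow> (real \<times> real \<Rightarrow> real) \<Rightarrow> (real \<times> real \<Rightarrow> real))
       (F :: nat \<Rightarrow> real \<times> real \<Rightarrow> real).
        scale_function ({a..b} \<times> {c..d}) \<alpha> \<longrightarrow>
        (\<forall>n. L n \<in> Lip ({a..b} \<times> {c..d}) \<rightarrow> Lip ({a..b} \<times> {c..d})) \<longrightarrow>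
        (\<forall>n. \<forall>p \<in> {a, b} \<times> {c, d}. L n f p = f p) \<longrightarrow>
        uniform_limit ({a..b} \<times> {c..d}) (\<lambda>n. L n f) f sequentially \<longrightarrow>
        (\<forall>n. is_alpha_fractal_function a b c d x y \<alpha> (L n) f (F n)) \<longrightarrow>
        uniform_limit ({a..b} \<times> {c..d}) F f sequentially)
     \<and>
     (\<forall>(\<alpha> :: nat \<Rightarrow> nat \<Rightarrow> nat \<Rightarrow> real \<times> real \<Rightarrow> real)
       (L :: (real \<times> real \<Rightarrow> real) \<Rightarrow> (real \<times> real \<Rightarrow> real))
       (F :: nat \<Rightarrow> real \<times> real \<Rightarrow> real).
        L \<in> Lip ({a..b} \<times> {c..d}) \<rightarrow> Lip ({a..b} \<times> {c..d}) \<longrightarrow>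
        (\<forall>h \<in> Lip ({a..b} \<times> {c..d}). \<forall>p \<in> {a, b} \<times> {c, d}. L h p = h p) \<longrightarrow>
        (\<forall>n. scale_function ({a..b} \<times> {c..d}) (\<alpha> n)) \<longrightarrow>
        (\<lambda>n. scale_norm ({a..b} \<times> {c..d}) (\<alpha> n)) \<longlonglongrightarrow> 0 \<longrightarrow>
        (\<forall>n. is_alpha_fractal_function a b c d x y (\<alpha> n) L f (F n)) \<longrightarrow>
        uniform_limit ({a..b} \<times> {c..d}) F f sequentially)"
proof (intro conjI allI impI)
  let ?S = "{a..b} \<times> {c..d}"
  have f: "continuous_on ?S f"
    using assms(5) by (rule Lip_continuous_on)
  have nonempty: "?S \<noteq> {}"
    using assms(1,2) by auto
  {
    fix \<alpha> :: "nat \<Rightarrow> nat \<Rightarrow> real \<times> real \<Rightarrow> real"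
      and L :: "nat \<Rightarrow> (real \<times> real \<Rightarrow> real) \<Rightarrow> (real \<times> real \<Rightarrow> real)"
      and F :: "nat \<Rightarrow> real \<times> real \<Rightarrow> real"
    assume \<alpha>: "scale_function ?S \<alpha>"
      and lim: "uniform_limit ?S (\<lambda>n. L n f) f sequentially"
      and F: "\<forall>n. is_alpha_fractal_function a b c d x y \<alpha> (L n) f (F n)"
    obtain r where r: "0 \<le> r" "r < 1"
      "\<And>i j p. i \<ge> 1 \<Longrightarrow> j \<ge> 1 \<Longrightarrow> p \<in> ?S \<Longrightarrow> \<bar>\<alpha> i j p\<bar> \<le> r"
      using scale_function_bound[OF \<alpha> nonempty] by metis
    show "uniform_limit ?S F f sequentially"
    proof (rule uniform_limitI)
      fix \<epsilon> :: real
      assume \<epsilon>: "0 < \<epsilon>"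
      \<comment> \<open>This tolerance cancels the factor \<open>1 / (1 - r)\<close> of the error
        bound and leaves \<open>r * \<epsilon>\<close>, which is below \<epsilon>.\<close>
      have "0 < \<epsilon> * (1 - r)" using \<epsilon> r by simp
      then have "\<forall>\<^sub>F n in sequentially. \<forall>p\<in>?S. dist (L n f p) (f p) < \<epsilon> * (1 - r)"
        using lim by (rule uniform_limitD[rotated])
      then show "\<forall>\<^sub>F n in sequentially. \<forall>p\<in>?S. dist (F n p) (f p) < \<epsilon>"
      proof (eventually_elim, intro ballI)
        fix n p
        assume n: "\<forall>p\<in>?S. dist (L n f p) (f p) < \<epsilon> * (1 - r)" and p: "p \<in> ?S"
        have e: "\<bar>L n f q - f q\<bar> \<le> \<epsilon> * (1 - r)" if "q \<in> ?S" for q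
          using bspec[OF n that] by (simp add: dist_real_def)
        have "\<bar>F n p - f p\<bar> \<le> r / (1 - r) * (\<epsilon> * (1 - r))"
          using alpha_fractal_function_error[OF assms(1-4) f F[rule_format, of n] r e p] .
        also have "\<dots> = r * \<epsilon>" using r by simp
        also have "\<dots> < \<epsilon>" using r \<epsilon> by simp
        finally show "dist (F n p) (f p) < \<epsilon>" by (simp add: dist_real_def)
      qed
    qed
  next
    fix \<alpha> :: "nat \<Rightarrow> nat \<Rightarrow> nat \<Rightarrow> real \<times> real \<Rightarrow> real"
      and L :: "(real \<times> real \<Rightarrow> real) \<Rightarrow> (real \<times> real \<Rightarrow> real)"
      and F :: "nat \<Rightarrow> real \<times> real \<Rightarrow> real"
    assume L: "L \<in> Lip ?S \<rightarrow> Lip ?S"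
      and \<alpha>: "\<forall>n. scale_function ?S (\<alpha> n)"
      and lim: "(\<lambda>n. scale_norm ?S (\<alpha> n)) \<longlonglongrightarrow> 0"
      and F: "\<forall>n. is_alpha_fractal_function a b c d x y (\<alpha> n) L f (F n)"
    have "\<forall>n. \<exists>r. scale_norm ?S (\<alpha> n) = ereal r \<and> 0 \<le> r \<and> r < 1 \<and>
        (\<forall>i j p. i \<ge> 1 \<longrightarrow> j \<ge> 1 \<longrightarrow> p \<in> ?S \<longrightarrow> \<bar>\<alpha> n i j p\<bar> \<le> r)"
      using scale_function_bound[OF \<alpha>[rule_format] nonempty] by metis
    then obtain r where r: "\<And>n. scale_norm ?S (\<alpha> n) = ereal (r n)" "\<And>n. 0 \<le> r n" "\<And>n. r n < 1"
      "\<And>n i j p. i \<ge> 1 \<Longrightarrow> j \<ge> 1 \<Longrightarrow> p \<in> ?S \<Longrightarrow> \<bar>\<alpha> n i j p\<bar> \<le> r n"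
      by metis
    have "r \<longlonglongrightarrow> 0"
      using lim by (simp add: r(1) zero_ereal_def)
    \<comment> \<open>Since \<open>L\<close> maps into Lipschitz functions, \<open>L f - f\<close>
      is continuous on a compact rectangle. This yields a bound \<open>e\<close> that does not
      depend on \<open>n\<close>.\<close>
    have "continuous_on ?S (L f)"
      using L assms(5) by (intro Lip_continuous_on) auto
    then have "continuous_on ?S (\<lambda>p. L f p - f p)"
      using f by (intro continuous_intros)
    then have "compact ((\<lambda>p. L f p - f p) ` ?S)"
      by (intro compact_continuous_image compact_Times) auto
    then obtain e where e: "\<And>p. p \<in> ?S \<Longrightarrow> \<bar>L f p - f p\<bar> \<le> e"
      using compact_imp_bounded[THEN bounded_iff[THEN iffD1]] by fastforce
    \<comment> \<open>The denominators tend to 1, so the quotient rule for limits applies.\<close>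
    have "(\<lambda>n. r n / (1 - r n) * e) \<longlonglongrightarrow> 0 / (1 - 0) * e"
      using \<open>r \<longlonglongrightarrow> 0\<close> by (intro tendsto_intros) auto
    then have bound_lim: "(\<lambda>n. r n / (1 - r n) * e) \<longlonglongrightarrow> 0" by simp
    show "uniform_limit ?S F f sequentially"
    proof (rule uniform_limitI)
      fix \<epsilon> :: real
      assume "0 < \<epsilon>"
      then have "\<forall>\<^sub>F n in sequentially. r n / (1 - r n) * e < \<epsilon>"
        using bound_lim by (rule order_tendstoD(2)[rotated])
      then show "\<forall>\<^sub>F n in sequentially. \<forall>p\<in>?S. dist (F n p) (f p) < \<epsilon>"
      proof (eventually_elim, intro ballI)
        fix n p
        assume n: "r n / (1 - r n) * e < \<epsilon>" and p: "p \<in> ?S"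
        have "\<bar>F n p - f p\<bar> \<le> r n / (1 - r n) * e"
          using alpha_fractal_function_error[OF assms(1-4) f F[rule_format, of n] r(2-4) e p] .
        with n show "dist (F n p) (f p) < \<epsilon>" by (simp add: dist_real_def)
      qed
    qed
  }
qed

end
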